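(* Let $X$ be a $T_0$ space such that its Smyth power space $P^s(X)$ is weakly sober. Then $X$ is weakly sober.
   Context: For a topological space $X$, the specialization preorder is $x\le y$ iff $x\in\mathrm{cl}\{y\}$; all order-theoretic notions in $X$ refer to it. For $A\subseteq X$, $A^{\uparrow}$ and $A^{\downarrow}$ denote the sets of all upper, respectively lower, bounds of $A$ in $X$, and $A^{\delta}=(A^{\uparrow})^{\downarrow}$ is the cut closure of $A$; $A$ is a cut if $A=A^{\delta}$. Irreducible closed sets are nonempty. $X$ is weakly sober if it is $T_0$ and every irreducible closed subset $A$ of $X$ is a cut, i.e. an intersection of point closures (the whole space being the empty intersection). The Smyth power space $P^s(X)$ is the set $K(X)$ of nonempty compact saturated subsets of $X$ (saturated = intersection of open sets, equivalently an upper set), with the upper Vietoris topology generated by the sets $\Box U=\{K\in K(X):K\subseteq U\}$, $U$ open in $X$; its specialization order is reverse inclusion. *)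

theory Defs
  imports "HOL-Analysis.Analysis"
begin

(* No membership guards are needed: "X closure_of {y}" is a subset of the space and is
   empty if y is not a point of X, so both x and y are points of X. *)
definition specialization_le :: "'a topology \<Rightarrow> 'a \<Rightarrow> 'a \<Rightarrow> bool" where
  "specialization_le X x y \<longleftrightarrow> x \<in> X closure_of {y}"

definition upper_bounds :: "'a topology \<Rightarrow> 'a set \<Rightarrow> 'a set" where
  "upper_bounds X A = {u \<in> topspace X. \<forall>a\<in>A. specialization_le X a u}"

definition lower_bounds :: "'a topology \<Rightarrow> 'a set \<Rightarrow> 'a set" where
  "lower_bounds X A = {l \<in> topspace X. \<forall>a\<in>A. specialization_le X l a}"

definition cut_closure :: "'a topology \<Rightarrow> 'a set \<Rightarrow> 'a set" where
  "cut_closure X A = lower_bounds X (upper_bounds X A)"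

definition is_cut :: "'a topology \<Rightarrow> 'a set \<Rightarrow> bool" where
  "is_cut X A \<longleftrightarrow> A \<subseteq> topspace X \<and> A = cut_closure X A"

definition irreducible_closed :: "'a topology \<Rightarrow> 'a set \<Rightarrow> bool" where
  "irreducible_closed X A \<longleftrightarrow>
     closedin X A \<and> A \<noteq> {} \<and>
     (\<forall>B C. closedin X B \<and> closedin X C \<and> A \<subseteq> B \<union> C \<longrightarrow> A \<subseteq> B \<or> A \<subseteq> C)"

definition weakly_sober :: "'a topology \<Rightarrow> bool" where
  "weakly_sober X \<longleftrightarrow> t0_space X \<and> (\<forall>A. irreducible_closed X A \<longrightarrow> is_cut X A)"

(* Intersecting with the space makes the empty intersection equal to the whole space. *)
definition saturatedin :: "'a topology \<Rightarrow> 'a set \<Rightarrow> bool" where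
  "saturatedin X S \<longleftrightarrow> (\<exists>\<U>. (\<forall>U\<in>\<U>. openin X U) \<and> S = topspace X \<inter> \<Inter>\<U>)"

definition compact_saturated_sets :: "'a topology \<Rightarrow> 'a set set" where
  "compact_saturated_sets X = {K. K \<noteq> {} \<and> compactin X K \<and> saturatedin X K}"

definition Smyth_box :: "'a topology \<Rightarrow> 'a set \<Rightarrow> 'a set set" where
  "Smyth_box X U = {K \<in> compact_saturated_sets X. K \<subseteq> U}"

definition Smyth_power_space :: "'a topology \<Rightarrow> 'a set topology" where
  "Smyth_power_space X = topology_generated_by {Smyth_box X U |U. openin X U}"

lemma is_cut_iff_Inter_point_closures:
  "is_cut X A \<longleftrightarrow> (\<exists>Y \<subseteq> topspace X. A = topspace X \<inter> (\<Inter>y\<in>Y. X closure_of {y}))"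
  (is "?L \<longleftrightarrow> ?R")
proof
  assume ?L
  then have "upper_bounds X A \<subseteq> topspace X"
    and "A = topspace X \<inter> (\<Inter>y\<in>upper_bounds X A. X closure_of {y})"
    unfolding is_cut_def cut_closure_def
    by (auto simp: upper_bounds_def lower_bounds_def specialization_le_def)
  then show ?R by blast
next
  assume ?R
  then show ?L
    unfolding is_cut_def cut_closure_def upper_bounds_def lower_bounds_def specialization_le_def
    by blast
qed

lemma saturatedin_iff_upper_set:
  "saturatedin X S \<longleftrightarrow>
     S \<subseteq> topspace X \<and> (\<forall>x y. x \<in> S \<and> specialization_le X x y \<longrightarrow> y \<in> S)"
  (is "?L \<longleftrightarrow> ?R")
proof
  assume ?L
  then obtain \<U> where U: "\<forall>U\<in>\<U>. openin X U" "S = topspace X \<inter> \<Inter>\<U>"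
    unfolding saturatedin_def by blast
  have "y \<in> S" if "x \<in> S" "specialization_le X x y" for x y
    using that U unfolding specialization_le_def in_closure_of
    by blast
  then show ?R using U by blast
next
  assume R: ?R
  let ?U = "(\<lambda>y. topspace X - X closure_of {y}) ` (topspace X - S)"
  have "y \<in> X closure_of {y}" if "y \<in> topspace X" for y
    using that by (auto simp: in_closure_of)
  then have "S = topspace X \<inter> \<Inter>?U"
    using R unfolding specialization_le_def by auto
  moreover have "\<forall>U\<in>?U. openin X U"
    by auto
  ultimately show ?L unfolding saturatedin_def by blast
qed

lemma topspace_Smyth_power_space:
  "topspace (Smyth_power_space X) = compact_saturated_sets X"
proof -
  have "Smyth_box X (topspace X) = compact_saturated_sets X"
    by (auto simp: Smyth_box_def compact_saturated_sets_def compactin_def)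
  then show ?thesis
    unfolding Smyth_power_space_def topology_generated_by_topspace
    using Smyth_box_def by blast
qed

lemma specialization_le_Smyth_power_space:
  "specialization_le (Smyth_power_space X) K L \<longleftrightarrow>
     K \<in> compact_saturated_sets X \<and> L \<in> compact_saturated_sets X \<and> L \<subseteq> K"
  (is "?L \<longleftrightarrow> ?R")
proof
  assume le: ?L
  then have K: "K \<in> compact_saturated_sets X"
    by (auto simp: specialization_le_def in_closure_of topspace_Smyth_power_space)
  have box: "openin (Smyth_power_space X) (Smyth_box X U)" if "openin X U" for U
    unfolding Smyth_power_space_def using that by (intro topology_generated_by_Basis) blast
  have *: "L \<in> Smyth_box X U" if "openin X U" "K \<subseteq> U" for U
  proof -
    have "K \<in> Smyth_box X U"
      using K that(2) by (simp add: Smyth_box_def)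
    then show ?thesis
      using le box[OF that(1)] unfolding specialization_le_def in_closure_of by blast
  qed
  obtain \<U> where U: "\<forall>U\<in>\<U>. openin X U" "K = topspace X \<inter> \<Inter>\<U>"
    using K unfolding compact_saturated_sets_def saturatedin_def by blast
  have "L \<subseteq> K" using U * unfolding Smyth_box_def by blast
  moreover have "L \<in> compact_saturated_sets X"
    using *[OF openin_topspace] U unfolding Smyth_box_def by blast
  ultimately show ?R using K by blast
next
  assume R: ?R
  have "L \<in> T" if "generate_topology_on {Smyth_box X U |U. openin X U} T" "K \<in> T" for T
    using that by (induction rule: generate_topology_on.induct) (use R in \<open>auto simp: Smyth_box_def\<close>)
  then show ?L using R
    unfolding specialization_le_def in_closure_of topspace_Smyth_power_space
    by (auto simp: Smyth_power_space_def openin_topology_generated_by_iff)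
qed

end

(* The map sending x to its principal filter is continuous into the Smyth power space. If A is
   irreducible closed in X, then the compact saturated sets meeting A form an irreducible closed
   set there, hence a cut. Their upper bounds are exactly the compact saturated sets of upper
   bounds of A, so if x lies in the cut closure of A, the principal filter of x lies in that cut,
   i.e. meets A; since A is a lower set, x is in A. *)
theory Submission
  imports Defs
begin

text \<open>For a point \<open>x\<close> of the space this is the saturation of \<open>{x}\<close>,
  the smallest saturated set containing \<open>x\<close>.\<close>

definition principal_filter :: "'a topology \<Rightarrow> 'a \<Rightarrow> 'a set" where
  "principal_filter X x = {y. specialization_le X x y}"

lemma specialization_le_topspace:
  assumes "specialization_le X x y"
  shows "x \<in> topspace X" "y \<in> topspace X"
  \<comment> \<open>The whole space is an open neighbourhood of \<open>x\<close>, so it must contain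
    \<open>y\<close>.\<close>
  using assms openin_topspace[of X] by (auto simp: specialization_le_def in_closure_of)

lemma specialization_le_refl: "x \<in> topspace X \<Longrightarrow> specialization_le X x x"
  by (auto simp: specialization_le_def in_closure_of)

lemma specialization_le_trans:
  assumes "specialization_le X x y" "specialization_le X y z"
  shows "specialization_le X x z"
  using assms by (auto simp: specialization_le_def in_closure_of)

lemma specialization_le_openin:
  assumes "specialization_le X x y" "openin X U" "x \<in> U"
  shows "y \<in> U"
  using assms by (auto simp: specialization_le_def in_closure_of)

lemma specialization_le_closedin:
  assumes "specialization_le X x y" "closedin X C" "y \<in> C"
  shows "x \<in> C"
  using assms closure_of_minimal[of "{y}" C X] by (auto simp: specialization_le_def)

text \<open>Open sets are upper sets, so \<open>x\<close> alone decides. This is what makes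
  \<open>U\<close> the preimage of \<open>Smyth_box X U\<close> under the principal filter
  map.\<close>

lemma principal_filter_subset_openin_iff:
  assumes "x \<in> topspace X" "openin X U"
  shows "principal_filter X x \<subseteq> U \<longleftrightarrow> x \<in> U"
  using assms specialization_le_refl specialization_le_openin
  unfolding principal_filter_def by fast

lemma principal_filter_subset_compact_saturated:
  assumes "K \<in> compact_saturated_sets X" "x \<in> K"
  shows "principal_filter X x \<subseteq> K"
  using assms unfolding compact_saturated_sets_def saturatedin_iff_upper_set principal_filter_def
  by blast

lemma principal_filter_compact_saturated:
  assumes x: "x \<in> topspace X"
  shows "principal_filter X x \<in> compact_saturated_sets X"
proof -
  have "compactin X (principal_filter X x)"
    unfolding compactin_def
  proof (intro conjI allI impI)
    show "principal_filter X x \<subseteq> topspace X"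
      by (auto simp: principal_filter_def dest: specialization_le_topspace)
  next
    fix \<U> assume \<U>: "(\<forall>U\<in>\<U>. openin X U) \<and> principal_filter X x \<subseteq> \<Union>\<U>"
    then obtain U where "U \<in> \<U>" "x \<in> U"
      using specialization_le_refl[OF x] by (auto simp: principal_filter_def)
    then show "\<exists>\<F>. finite \<F> \<and> \<F> \<subseteq> \<U> \<and> principal_filter X x \<subseteq> \<Union>\<F>"
      \<comment> \<open>A single member of the cover suffices: being open and containing
        \<open>x\<close>, it contains everything above \<open>x\<close>.\<close>
      using \<U> principal_filter_subset_openin_iff[OF x] by (intro exI[of _ "{U}"]) auto
  qed
  moreover have "saturatedin X (principal_filter X x)"
    unfolding saturatedin_iff_upper_set principal_filter_def
    using specialization_le_topspace specialization_le_trans by fast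
  moreover have "principal_filter X x \<noteq> {}"
    using specialization_le_refl[OF x] by (auto simp: principal_filter_def)
  ultimately show ?thesis
    by (simp add: compact_saturated_sets_def)
qed

lemma continuous_map_principal_filter:
  "continuous_map X (Smyth_power_space X) (principal_filter X)"
  unfolding Smyth_power_space_def continuous_on_generated_topo_iff
proof (intro conjI allI impI)
  fix \<V> assume "\<V> \<in> {Smyth_box X U |U. openin X U}"
  then obtain U where U: "\<V> = Smyth_box X U" "openin X U" by blast
  have "principal_filter X x \<in> \<V> \<longleftrightarrow> x \<in> U" if "x \<in> topspace X" for x
    using that U by (simp add: Smyth_box_def principal_filter_compact_saturated
        principal_filter_subset_openin_iff)
  then have "principal_filter X -` \<V> \<inter> topspace X = U"
    using openin_subset[OF U(2)] by blast
  then show "openin X (principal_filter X -` \<V> \<inter> topspace X)"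
    using U by simp
next
  show "principal_filter X ` topspace X \<subseteq> \<Union>{Smyth_box X U |U. openin X U}"
    \<comment> \<open>The union of the generating boxes is the carrier of the power space, so only
      membership in \<open>compact_saturated_sets X\<close> remains.\<close>
    unfolding topspace_Smyth_power_space[of X, unfolded Smyth_power_space_def
        topology_generated_by_topspace]
    by (simp add: image_subset_iff principal_filter_compact_saturated)
qed

text \<open>Missing \<open>A\<close> means lying inside its open complement, so the complementary
  family is a subbasic box.\<close>

lemma closedin_Smyth_meets:
  assumes "closedin X A"
  shows "closedin (Smyth_power_space X) {K \<in> compact_saturated_sets X. K \<inter> A \<noteq> {}}"
proof -
  have "openin (Smyth_power_space X) (Smyth_box X (topspace X - A))"
    unfolding Smyth_power_space_def using assms by (intro topology_generated_by_Basis) blast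
  moreover have "compact_saturated_sets X - {K \<in> compact_saturated_sets X. K \<inter> A \<noteq> {}}
      = Smyth_box X (topspace X - A)"
    by (auto simp: Smyth_box_def compact_saturated_sets_def compactin_def)
  ultimately show ?thesis
    unfolding closedin_def topspace_Smyth_power_space by (simp only:) blast
qed

text \<open>The family is the closure of the image of \<open>A\<close> under the continuous
  principal filter map, and irreducibility passes to continuous images and to closures.\<close>

lemma irreducible_closed_Smyth_meets:
  assumes "irreducible_closed X A"
  shows "irreducible_closed (Smyth_power_space X) {K \<in> compact_saturated_sets X. K \<inter> A \<noteq> {}}"
    (is "irreducible_closed ?P ?\<A>")
proof -
  have cl: "closedin X A" and ne: "A \<noteq> {}"
    and irr: "\<And>B C. closedin X B \<Longrightarrow> closedin X C \<Longrightarrow> A \<subseteq> B \<union> C \<Longrightarrow> A \<subseteq> B \<or> A \<subseteq> C"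
    using assms unfolding irreducible_closed_def by auto
  have AX: "A \<subseteq> topspace X" using cl by (rule closedin_subset)
  have filter_mem: "principal_filter X a \<in> ?\<A>" if "a \<in> A" for a
    using that AX specialization_le_refl[of a X] principal_filter_compact_saturated[of a X]
    by (auto simp: principal_filter_def)
  \<comment> \<open>Closed families are pulled back to \<open>X\<close>, where the irreducibility of
    \<open>A\<close> applies.\<close>
  define pre where "pre \<B> = {x \<in> topspace X. principal_filter X x \<in> \<B>}" for \<B>
  have pre_closed: "closedin X (pre \<B>)" if "closedin ?P \<B>" for \<B>
    unfolding pre_def
    using continuous_map_principal_filter that by (rule closedin_continuous_map_preimage)
  \<comment> \<open>If \<open>K\<close> meets \<open>A\<close> in \<open>a\<close>, then
    \<open>K\<close> lies below the principal filter of \<open>a\<close> in the reverse inclusion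
    order, and closed families are lower sets.\<close>
  have lift: "?\<A> \<subseteq> \<B>" if "closedin ?P \<B>" "A \<subseteq> pre \<B>" for \<B>
  proof
    fix K assume "K \<in> ?\<A>"
    then obtain a where a: "K \<in> compact_saturated_sets X" "a \<in> K" "a \<in> A" by blast
    then have "specialization_le ?P K (principal_filter X a)"
      using principal_filter_subset_compact_saturated[OF a(1,2)] filter_mem[OF a(3)]
      by (simp add: specialization_le_Smyth_power_space)
    then show "K \<in> \<B>"
      using specialization_le_closedin that a(3) unfolding pre_def by fast
  qed
  have "?\<A> \<subseteq> \<B> \<or> ?\<A> \<subseteq> \<C>" if "closedin ?P \<B>" "closedin ?P \<C>" "?\<A> \<subseteq> \<B> \<union> \<C>" for \<B> \<C>
  proof -
    have "A \<subseteq> pre \<B> \<union> pre \<C>"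
      using filter_mem that(3) AX unfolding pre_def by blast
    then have "A \<subseteq> pre \<B> \<or> A \<subseteq> pre \<C>"
      by (rule irr[OF pre_closed[OF that(1)] pre_closed[OF that(2)]])
    then show ?thesis
      using lift[OF that(1)] lift[OF that(2)] by (rule disj_forward)
  qed
  moreover have "?\<A> \<noteq> {}" using filter_mem ne by blast
  ultimately show ?thesis
    using closedin_Smyth_meets[OF cl] unfolding irreducible_closed_def by blast
qed

lemma is_cut_if_Smyth_meets_is_cut:
  assumes cl: "closedin X A"
    and cut: "is_cut (Smyth_power_space X) {K \<in> compact_saturated_sets X. K \<inter> A \<noteq> {}}"
      (is "is_cut ?P ?\<A>")
  shows "is_cut X A"
proof -
  have AX: "A \<subseteq> topspace X" using cl by (rule closedin_subset)
  have "x \<in> A" if x: "x \<in> cut_closure X A" for x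
  proof -
    have xX: "x \<in> topspace X" and low: "\<And>u. u \<in> upper_bounds X A \<Longrightarrow> specialization_le X x u"
      using x by (auto simp: cut_closure_def lower_bounds_def)
    have "specialization_le ?P (principal_filter X x) L" if L: "L \<in> upper_bounds ?P ?\<A>" for L
    proof -
      have Lcs: "L \<in> compact_saturated_sets X"
        using L by (auto simp: upper_bounds_def topspace_Smyth_power_space)
      \<comment> \<open>The principal filter of \<open>a\<close> contains \<open>a\<close>, so it
        belongs to the family bounded by \<open>L\<close>; lying above it means being contained in
        it.\<close>
      have "L \<subseteq> principal_filter X a" if "a \<in> A" for a
      proof -
        have "principal_filter X a \<in> ?\<A>"
          using that AX specialization_le_refl[of a X] principal_filter_compact_saturated[of a X]
          by (auto simp: principal_filter_def)
        then show ?thesis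
          using L unfolding upper_bounds_def specialization_le_Smyth_power_space by blast
      qed
      moreover have "L \<subseteq> topspace X"
        using Lcs by (auto simp: compact_saturated_sets_def compactin_def)
      \<comment> \<open>A point of \<open>L\<close> lies in the principal filter of every
        \<open>a\<close> in \<open>A\<close>, so it is above all of \<open>A\<close>;
        \<open>low\<close> then puts it above \<open>x\<close>.\<close>
      ultimately have "L \<subseteq> upper_bounds X A"
        by (auto simp: upper_bounds_def principal_filter_def)
      then have "L \<subseteq> principal_filter X x"
        using low by (auto simp: principal_filter_def)
      then show ?thesis
        using Lcs xX by (simp add: specialization_le_Smyth_power_space
            principal_filter_compact_saturated)
    qed
    then have "principal_filter X x \<in> cut_closure ?P ?\<A>"
      using xX by (auto simp: cut_closure_def lower_bounds_def topspace_Smyth_power_space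
          principal_filter_compact_saturated)
    then have "principal_filter X x \<in> ?\<A>"
      using cut unfolding is_cut_def by blast
    then show "x \<in> A"
      using specialization_le_closedin[OF _ cl] by (auto simp: principal_filter_def)
  qed
  moreover have "A \<subseteq> cut_closure X A"
    using AX by (auto simp: cut_closure_def lower_bounds_def upper_bounds_def)
  ultimately show ?thesis
    using AX unfolding is_cut_def by blast
qed

theorem theorem3p15:
  fixes X :: "'a topology"
  assumes "t0_space X"
    and "weakly_sober (Smyth_power_space X)"
  shows "weakly_sober X"
  unfolding weakly_sober_def
proof (intro conjI allI impI)
  show "t0_space X" by (fact assms(1))
next
  fix A assume A: "irreducible_closed X A"
  show "is_cut X A"
  proof (rule is_cut_if_Smyth_meets_is_cut)
    show "closedin X A"
      using A by (simp add: irreducible_closed_def)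
    show "is_cut (Smyth_power_space X) {K \<in> compact_saturated_sets X. K \<inter> A \<noteq> {}}"
      using assms(2) irreducible_closed_Smyth_meets[OF A] by (simp add: weakly_sober_def)
  qed
qed

end
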